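(* Let $n,N$ be positive integers with $N>n$, let $t\in\mathbb{R}$, and let $K_t(z)=\frac{(\operatorname{Re} z)^{2N-1}}{|z|^{2N}}+t\cdot\frac{(\operatorname{Re} z)^{2n-1}}{|z|^{2n}}$ for $z\in\mathbb{C}\setminus\{0\}$. Put $\rho_{n,N}:=\left(\frac{N}{n}-2\right)\sqrt{N-2n}$ when $N\ge 2n$. Suppose that either $t=0$, or $$t\in\mathbb{R}\setminus\left(-\tfrac12\left(3+\sqrt{9-4\tfrac{N}{n}}\right);\ 2-\tfrac{N}{n}\right)\quad\text{in the case } n<N\le 2n,$$ or $$t\in\mathbb{R}\setminus\left(-\tfrac12\left(3+\rho_{n,N}+\sqrt{(3+\rho_{n,N})^2-4\tfrac{N}{n}}\right);\ \rho_{n,N}\right)\quad\text{in the case } N\ge 2n$$ (in particular, for $N=2n$ the condition is $t\in\mathbb{R}\setminus(-2;0)$). Then $$p_{K_t}(z_1,z_2,z_3)\ge 0$$ for all pairwise distinct $z_1,z_2,z_3\in\mathbb{C}$. Furthermore, the range of $t$ in the case $N=2n$ is sharp: if $N=2n$ and $t\in(-2;0)$, then there exist pairwise distinct $z_1,z_2,z_3\in\mathbb{C}$ with $p_{K_t}(z_1,z_2,z_3)<0$.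
   Context: Intervals $(a;b)$ are open intervals. For a real-valued kernel $K:\mathbb{C}\setminus\{0\}\to\mathbb{R}$ and pairwise distinct points $z_1,z_2,z_3\in\mathbb{C}$, $$p_K(z_1,z_2,z_3):=K(z_1-z_2)K(z_1-z_3)+K(z_2-z_1)K(z_2-z_3)+K(z_3-z_1)K(z_3-z_2).$$ *)

theory Defs
  imports Complex_Main
begin

text \<open>Kernels on the punctured plane are total functions on \<^typ>\<open>complex\<close>. Their value at \<open>0\<close>
  plays no role, since \<open>p_sym\<close> is only considered at pairwise distinct points.\<close>

definition p_sym :: "(complex \<Rightarrow> real) \<Rightarrow> complex \<Rightarrow> complex \<Rightarrow> complex \<Rightarrow> real" where
  "p_sym K z1 z2 z3 =
     K (z1 - z2) * K (z1 - z3) + K (z2 - z1) * K (z2 - z3) + K (z3 - z1) * K (z3 - z2)"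

definition Kt :: "nat \<Rightarrow> nat \<Rightarrow> real \<Rightarrow> complex \<Rightarrow> real" where
  "Kt n N t z =
     Re z ^ (2 * N - 1) / cmod z ^ (2 * N) + t * (Re z ^ (2 * n - 1) / cmod z ^ (2 * n))"

definition rho :: "nat \<Rightarrow> nat \<Rightarrow> real" where
  "rho n N = (real N / real n - 2) * sqrt (real N - 2 * real n)"

definition admissible :: "nat \<Rightarrow> nat \<Rightarrow> real \<Rightarrow> bool" where
  "admissible n N t \<longleftrightarrow>
     t = 0 \<or>
     (n < N \<and> N \<le> 2 * n \<and>
        t \<notin> {- (1/2) * (3 + sqrt (9 - 4 * (real N / real n))) <..< 2 - real N / real n}) \<or>
     (2 * n \<le> N \<and>
        t \<notin> {- (1/2) * (3 + rho n N + sqrt ((3 + rho n N)\<^sup>2 - 4 * (real N / real n))) <..< rho n N})"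

end

theory Submission
  imports Defs "HOL-Analysis.Convex"
begin

text \<open>Writing \<open>z = x (1 + i q)\<close> with \<open>x = Re z\<close>, the kernel takes the form
  \<open>K\<^sub>t z = 1 / (x g(q))\<close> with \<open>g(q) = s\<^sup>N / (1 + t s\<^sup>m)\<close>, \<open>s = 1 + q\<^sup>2\<close>, \<open>m = N - n\<close>. If the points are
  ordered by real part, the slope of the long side of the triangle is a weighted mean of the slopes of
  the other two sides, and \<open>p \<ge> 0\<close> is Jensen's inequality for \<open>\<plusminus>g\<close>. Convexity of \<open>\<plusminus>g\<close> amounts to a polynomial
  inequality in \<open>q\<^sup>2\<close> and \<open>w = t s\<^sup>m\<close>, which holds when \<open>t \<ge> 0\<close>, \<open>N \<le> 2n\<close> and when \<open>t \<le> - N/n\<close>; for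
  \<open>N \<ge> 2n\<close>, \<open>t \<ge> \<rho>\<close> it follows from Bernoulli's inequality \<open>s\<^sup>m \<ge> 1 + m q\<^sup>2\<close>. Every admissible \<open>t \<noteq> 0\<close>
  falls into one of these ranges. For \<open>N = 2n\<close> and the slopes \<open>q, 0, -q\<close> the sign of \<open>p\<close> is that of
  \<open>(v + t) (1 + v + t)\<close> with \<open>v = s\<^sup>-\<^sup>n\<close>, which gives sharpness.\<close>

section \<open>Jensen's inequality for triangles\<close>

text \<open>Over a common positive denominator, \<open>p_sym\<close> is \<open>c\<^sup>2\<close>
  times the gap in Jensen's inequality. Only the square of \<open>c\<close> enters, so
  \<open>G\<close> can be kept positive whatever the sign of the kernel.\<close>

lemma p_sym_nonneg_if_convex_ordered:
  fixes K :: "complex \<Rightarrow> real" and G :: "real \<Rightarrow> real"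
  assumes conv: "convex_on UNIV G" and pos: "\<And>p. G p > 0"
    and K: "\<And>z. K z = c / (Re z * G (Im z / Re z))"
    and ord: "Re z3 \<le> Re z2" "Re z2 \<le> Re z1"
  shows "0 \<le> p_sym K z1 z2 z3"
proof -
  define a b where "a = z1 - z2" and "b = z2 - z3"
  have odd: "K (- z) = - K z" for z
    by (simp add: K)
  have p: "p_sym K z1 z2 z3 = K a * K (a + b) - K a * K b + K (a + b) * K b"
    using odd[of a] odd[of b] odd[of "a + b"] by (simp add: p_sym_def a_def b_def)
  have nn: "0 \<le> Re a" "0 \<le> Re b"
    using ord by (simp_all add: a_def b_def)
  have same: "0 \<le> K y * K z" if "0 \<le> Re y" "0 \<le> Re z" for y z
  proof -
    have "K y * K z = c\<^sup>2 / (Re y * G (Im y / Re y) * (Re z * G (Im z / Re z)))"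
      by (simp add: K power2_eq_square)
    moreover have "0 \<le> Re y * G (Im y / Re y) * (Re z * G (Im z / Re z))"
      using that pos by (intro mult_nonneg_nonneg) (auto intro: less_imp_le)
    ultimately show ?thesis by simp
  qed
  show ?thesis
  proof (cases "Re a = 0 \<or> Re b = 0")
    case True
    \<comment> \<open>A vertical side has kernel 0 by the convention \<open>x / 0 = 0\<close>. At
      most one product then survives, and its factors do not differ in sign.\<close>
    then have "K a = 0 \<or> K b = 0" by (auto simp: K)
    then show ?thesis
      using p same[of a "a + b"] same[of "a + b" b] nn by auto
  next
    case False
    define \<alpha> \<beta> where "\<alpha> = Re a" and "\<beta> = Re b"
    have ab: "\<alpha> > 0" "\<beta> > 0"
      using False nn by (auto simp: \<alpha>_def \<beta>_def)
    define A B R where "A = G (Im a / \<alpha>)" and "B = G (Im b / \<beta>)"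
      and "R = G ((Im a + Im b) / (\<alpha> + \<beta>))"
    have pos': "A > 0" "B > 0" "R > 0"
      using pos by (simp_all add: A_def B_def R_def)
    have "R \<le> (1 - \<beta> / (\<alpha> + \<beta>)) * A + \<beta> / (\<alpha> + \<beta>) * B"
    proof -
      have eq: "(1 - \<beta> / (\<alpha> + \<beta>)) *\<^sub>R (Im a / \<alpha>) + (\<beta> / (\<alpha> + \<beta>)) *\<^sub>R (Im b / \<beta>)
          = (Im a + Im b) / (\<alpha> + \<beta>)"
        using ab by (simp add: divide_simps)
      have "G ((1 - \<beta> / (\<alpha> + \<beta>)) *\<^sub>R (Im a / \<alpha>) + (\<beta> / (\<alpha> + \<beta>)) *\<^sub>R (Im b / \<beta>))
          \<le> (1 - \<beta> / (\<alpha> + \<beta>)) * G (Im a / \<alpha>) + \<beta> / (\<alpha> + \<beta>) * G (Im b / \<beta>)"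
        by (rule convex_onD[OF conv]) (use ab in auto)
      then show ?thesis
        unfolding eq A_def B_def R_def .
    qed
    also have "\<dots> = (\<alpha> * A + \<beta> * B) / (\<alpha> + \<beta>)"
      using ab by (simp add: divide_simps)
    finally have jensen: "(\<alpha> + \<beta>) * R \<le> \<alpha> * A + \<beta> * B"
      using ab by (simp add: pos_le_divide_eq mult.commute)
    have Kabr: "K a = c / (\<alpha> * A)" "K b = c / (\<beta> * B)" "K (a + b) = c / ((\<alpha> + \<beta>) * R)"
      by (simp_all add: K A_def B_def R_def \<alpha>_def \<beta>_def)
    have nz: "\<alpha> \<noteq> 0" "\<beta> \<noteq> 0" "\<alpha> + \<beta> \<noteq> 0" "A \<noteq> 0" "B \<noteq> 0" "R \<noteq> 0"
      using ab pos' by auto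
    have "p_sym K z1 z2 z3
        = c\<^sup>2 * (\<beta> * B + \<alpha> * A - (\<alpha> + \<beta>) * R) / (\<alpha> * \<beta> * (\<alpha> + \<beta>) * A * B * R)"
      unfolding p Kabr using nz
      by (simp add: divide_simps power2_eq_square) (simp add: algebra_simps)
    then show ?thesis
      using jensen ab pos' by simp
  qed
qed

lemma p_sym_nonneg_if_convex:
  fixes K :: "complex \<Rightarrow> real" and G :: "real \<Rightarrow> real"
  assumes "convex_on UNIV G" "\<And>p. G p > 0" "\<And>z. K z = c / (Re z * G (Im z / Re z))"
  shows "0 \<le> p_sym K z1 z2 z3"
proof -
  note ordered = p_sym_nonneg_if_convex_ordered[OF assms]
  have perm: "p_sym K x y z = p_sym K y x z" "p_sym K x y z = p_sym K x z y" for x y z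
    by (simp_all add: p_sym_def)
  show ?thesis
    by (metis linear ordered perm)
qed

section \<open>Convexity through the second derivative\<close>

text \<open>The expression in \<open>M\<close> is the second derivative up to the factor
  \<open>2 * c * s p ^ N / ((s p)\<^sup>2 * (1 + w p) ^ 3)\<close>, which is positive because
  \<open>pos\<close> gives \<open>c\<close> and \<open>1 + w p\<close> the same sign.\<close>

lemma convex_on_quotient:
  fixes n N :: nat and c t :: real
  defines "w \<equiv> \<lambda>p::real. t * (1 + p\<^sup>2) ^ (N - n)"
  assumes "n < N" and pos: "\<And>p. 0 < c * (1 + w p)"
    and M: "\<And>p. 0 \<le> (1 + p\<^sup>2) * ((1 + w p) * (real N + real n * w p))
      + 2 * p\<^sup>2 * (2 * (real N + real n * w p)\<^sup>2
          - (1 + w p) * (real N * (real N + 1) + real n * (real n + 1) * w p))"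
  shows "convex_on UNIV (\<lambda>p. c * (1 + p\<^sup>2) ^ N / (1 + w p))"
proof -
  define s :: "real \<Rightarrow> real" where "s = (\<lambda>p. 1 + p\<^sup>2)"
  have s: "s p > 0" "s p \<noteq> 0" for p
    by (simp_all add: s_def add_pos_nonneg less_imp_neq[symmetric])
  have ds: "(s has_real_derivative 2 * p) (at p)" for p
    unfolding s_def by (auto intro!: derivative_eq_intros)
  \<comment> \<open>The logarithmic derivative \<open>2 * p / s p\<close> is split off, so that no
    exponent \<open>k - 1\<close> occurs and all derivatives share one factor.\<close>
  have dpow: "((\<lambda>p. s p ^ k) has_real_derivative k * s p ^ k * (2 * p / s p)) (at p)" for k p
  proof -
    have "real k * s p ^ k * (2 * p / s p) = real k * (2 * p * s p ^ (k - Suc 0))"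
      using s(2)[of p] by (cases k) (auto simp: field_simps)
    then show ?thesis using DERIV_power[OF ds[of p], of k] by simp
  qed
  have dw: "(w has_real_derivative (real N - real n) * w p * (2 * p / s p)) (at p)" for p
    using DERIV_cmult[OF dpow[of "N - n" p], of t] \<open>n < N\<close>
    unfolding w_def s_def by (simp add: of_nat_diff mult_ac)
  have w: "1 + w p \<noteq> 0" for p
    using pos[of p] by auto
  define g where "g = (\<lambda>p. c * s p ^ N / (1 + w p))"
  define g' where "g' = (\<lambda>p. c * (2 * p / s p) * s p ^ N * (real N + real n * w p) / (1 + w p)\<^sup>2)"
  define g'' where "g'' = (\<lambda>p. 2 * c * s p ^ N / ((s p)\<^sup>2 * (1 + w p) ^ 3) *
     (s p * ((1 + w p) * (real N + real n * w p))
      + 2 * p\<^sup>2 * (2 * (real N + real n * w p)\<^sup>2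
          - (1 + w p) * (real N * (real N + 1) + real n * (real n + 1) * w p))))"
  have d1: "(g has_real_derivative g' p) (at p)" for p
    unfolding g_def g'_def
    apply (rule dpow dw ds | rule derivative_eq_intros refl w)+
    using s(2)[of p] w[of p]
    apply (simp add: divide_simps power2_eq_square)
    apply (simp add: algebra_simps)
    done
  have d2: "(g' has_real_derivative g'' p) (at p)" for p
    unfolding g'_def g''_def
    apply (rule dpow dw ds | rule derivative_eq_intros refl w s | (simp add: w; fail))+
    using s(2)[of p] w[of p]
    apply (simp add: divide_simps power2_eq_square power3_eq_cube)
    apply (simp add: algebra_simps)
    done
  have "g'' p \<ge> 0" for p
  proof -
    have "c / (1 + w p) ^ 3 \<ge> 0"
    proof -
      have "c / (1 + w p) ^ 3 = (c * (1 + w p)) / ((1 + w p)\<^sup>2)\<^sup>2"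
        using w[of p] by (simp add: divide_simps power_eq_if)
      then show ?thesis using pos[of p] by simp
    qed
    then have "0 \<le> (c / (1 + w p) ^ 3) * (2 * s p ^ N / (s p)\<^sup>2) *
      (s p * ((1 + w p) * (real N + real n * w p))
      + 2 * p\<^sup>2 * (2 * (real N + real n * w p)\<^sup>2
          - (1 + w p) * (real N * (real N + 1) + real n * (real n + 1) * w p)))"
      using M[of p] s(1)[of p] unfolding s_def[symmetric]
      by (intro mult_nonneg_nonneg) (auto simp: s_def)
    then show ?thesis by (simp add: g''_def mult_ac)
  qed
  then have "convex_on UNIV g"
    using d1 d2 by (intro f''_ge0_imp_convex[where f' = g' and f'' = g'']) auto
  then show ?thesis by (simp add: g_def s_def)
qed

section \<open>The kernel in terms of the slope\<close>

text \<open>For \<open>Re z = 0\<close> both sides vanish, by the convention \<open>x / 0 = 0\<close>. The sign \<open>c\<close> makes the function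
  multiplying \<open>Re z\<close> positive also for negative \<open>t\<close>.\<close>

lemma Kt_eq:
  fixes n N :: nat
  assumes "0 < n" "n < N" "c * c = 1"
  shows "Kt n N t z = c / (Re z * (c * (1 + (Im z / Re z)\<^sup>2) ^ N
           / (1 + t * (1 + (Im z / Re z)\<^sup>2) ^ (N - n))))"
proof (cases "Re z = 0")
  case True
  then show ?thesis using assms by (simp add: Kt_def power_0_left)
next
  case False
  define x where "x = Re z"
  define s where "s = 1 + (Im z / x)\<^sup>2"
  have x: "x \<noteq> 0" using False by (simp add: x_def)
  have "s > 0" by (simp add: s_def add_pos_nonneg)
  have c: "c \<noteq> 0" using assms by auto
  have "(cmod z)\<^sup>2 = x\<^sup>2 * s"
    using x by (simp add: cmod_power2 s_def x_def field_simps)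
  then have cm: "cmod z ^ (2 * k) = x ^ (2 * k) * s ^ k" for k
    by (simp add: power_mult power_mult_distrib)
  have summand: "x ^ (2 * k - 1) / cmod z ^ (2 * k) = 1 / (x * s ^ k)" if "0 < k" for k
  proof -
    have "x ^ (2 * k) = x * x ^ (2 * k - 1)"
      using that by (simp add: power_eq_if)
    then show ?thesis using x by (simp add: cm)
  qed
  have pw: "s ^ N = s ^ n * s ^ (N - n)"
    using assms by (simp add: power_add[symmetric])
  have "Kt n N t z = 1 / (x * s ^ N) + t * (1 / (x * s ^ n))"
    using assms summand[of N] summand[of n] by (simp add: Kt_def x_def)
  also have "\<dots> = (1 + t * s ^ (N - n)) / (x * s ^ N)"
    using x \<open>s > 0\<close> unfolding pw by (simp add: field_simps)
  also have "\<dots> = c / (x * (c * s ^ N / (1 + t * s ^ (N - n))))"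
    using c x \<open>s > 0\<close> by (simp add: field_simps)
  finally show ?thesis by (simp add: s_def x_def)
qed

section \<open>Polynomial inequalities in \<open>e\<close> and \<open>w\<close>\<close>

text \<open>The expression is affine in \<open>e\<close>, with constant term as in \<open>L\<close>
  and slope as in \<open>LQ\<close>.\<close>

lemma second_derivative_factor_nonneg:
  fixes n N w e :: real
  assumes L: "0 \<le> (1 + w) * (N + n * w)"
    and LQ: "0 \<le> (1 + w) * (N + n * w)
        + 2 * (2 * (N + n * w)\<^sup>2 - (1 + w) * (N * (N + 1) + n * (n + 1) * w))"
    and "0 \<le> e"
  shows "0 \<le> (1 + e) * ((1 + w) * (N + n * w))
      + 2 * e * (2 * (N + n * w)\<^sup>2 - (1 + w) * (N * (N + 1) + n * (n + 1) * w))"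
  using L mult_nonneg_nonneg[OF \<open>0 \<le> e\<close> LQ] by (simp add: algebra_simps)

text \<open>The slope in \<open>e\<close> is a quadratic in \<open>w\<close> with nonnegative
  coefficients; \<open>N \<le> 2 * n\<close> enters through the middle one.\<close>

lemma factor_nonneg_small_ratio:
  fixes n N w e :: real
  assumes "1 \<le> n" "n + 1 \<le> N" "N \<le> 2 * n" "0 \<le> w" "0 \<le> e"
  shows "0 \<le> (1 + e) * ((1 + w) * (N + n * w))
      + 2 * e * (2 * (N + n * w)\<^sup>2 - (1 + w) * (N * (N + 1) + n * (n + 1) * w))"
proof (rule second_derivative_factor_nonneg)
  define j where "j = N - n"
  have j: "1 \<le> j" "j \<le> n" "N = n + j" using assms by (auto simp: j_def)
  have "n * j \<ge> j * j" "n * j \<ge> n * 1" "n * j \<ge> 1 * j" "n * n \<ge> n * j"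
    using j assms by (auto intro!: mult_left_mono mult_right_mono)
  have lin: "0 \<le> 8 * n * N - 2 * N\<^sup>2 - 2 * n\<^sup>2 - N - n"
  proof -
    have "8 * n * N - 2 * N\<^sup>2 - 2 * n\<^sup>2 - N - n
        = 4 * (n * n) + 4 * (n * j) - 2 * (j * j) - 2 * n - j"
      unfolding j(3) by (simp add: algebra_simps power2_eq_square)
    then show ?thesis
      using \<open>n * j \<ge> j * j\<close> \<open>n * j \<ge> n * 1\<close> \<open>n * j \<ge> 1 * j\<close> \<open>n * n \<ge> n * j\<close> j(1) by linarith
  qed
  have "n * n \<ge> 1 * n" "N * N \<ge> 1 * N"
    using assms by (intro mult_right_mono; linarith)+
  then have quad: "0 \<le> n * (2 * n - 1)" "0 \<le> N * (2 * N - 1)"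
    using assms by (simp_all add: algebra_simps)
  have "(1 + w) * (N + n * w)
        + 2 * (2 * (N + n * w)\<^sup>2 - (1 + w) * (N * (N + 1) + n * (n + 1) * w))
      = n * (2 * n - 1) * w\<^sup>2 + (8 * n * N - 2 * N\<^sup>2 - 2 * n\<^sup>2 - N - n) * w + N * (2 * N - 1)"
    by (simp add: algebra_simps power2_eq_square)
  also have "\<dots> \<ge> 0"
    using lin quad assms by (intro add_nonneg_nonneg mult_nonneg_nonneg) auto
  finally show "0 \<le> (1 + w) * (N + n * w)
        + 2 * (2 * (N + n * w)\<^sup>2 - (1 + w) * (N * (N + 1) + n * (n + 1) * w))" .
qed (use assms in auto)

text \<open>With \<open>y = - w\<close>, the bounds \<open>1 \<le> n\<close> and \<open>prod\<close>
  show that the slope in \<open>e\<close> is at least a quadratic in \<open>y\<close> whose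
  coefficients are homogeneous in \<open>n\<close> and \<open>N\<close>. That quadratic is
  nonnegative by its coefficients or by its discriminant.\<close>

lemma factor_nonneg_negative:
  fixes n N w e :: real
  assumes "1 \<le> n" "n \<le> N" "n * w \<le> - N" "0 \<le> e"
  shows "0 \<le> (1 + e) * ((1 + w) * (N + n * w))
      + 2 * e * (2 * (N + n * w)\<^sup>2 - (1 + w) * (N * (N + 1) + n * (n + 1) * w))"
proof (rule second_derivative_factor_nonneg)
  define y where "y = - w"
  have "n * 1 \<le> n * y"
    unfolding y_def mult_minus_right mult_1_right using assms by linarith
  then have y: "1 \<le> y" "N \<le> n * y" "w = - y"
    using assms mult_left_le_imp_le[of n 1 y] by (auto simp: y_def)
  have prod: "0 \<le> (y - 1) * (n * y - N)" using y by simp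
  then show "0 \<le> (1 + w) * (N + n * w)" by (simp add: y(3) algebra_simps)
  have "0 \<le> n\<^sup>2 * y\<^sup>2 + (2 * N - n) * (N - 3 * n) * y + N * (2 * N - n)"
  proof (cases "3 * n \<le> N")
    case True
    then show ?thesis using assms y by (intro add_nonneg_nonneg mult_nonneg_nonneg) auto
  next
    case False
    \<comment> \<open>Now the linear coefficient is negative. This factorization says that the
      discriminant is not positive; completing the square after scaling by
      \<open>4 * n\<^sup>2\<close> finishes the case.\<close>
    have "0 \<le> (N - n)\<^sup>2 * (9 * n - 2 * N)"
      using False assms by (intro mult_nonneg_nonneg) auto
    also have "\<dots> = 4 * n\<^sup>2 * N - (2 * N - n) * (3 * n - N)\<^sup>2"
      by (simp add: algebra_simps power2_eq_square)
    finally have "0 \<le> (2 * n\<^sup>2 * y - (2 * N - n) * (3 * n - N))\<^sup>2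
        + (2 * N - n) * (4 * n\<^sup>2 * N - (2 * N - n) * (3 * n - N)\<^sup>2)"
      using assms by (intro add_nonneg_nonneg mult_nonneg_nonneg) auto
    also have "\<dots> = 4 * n\<^sup>2 * (n\<^sup>2 * y\<^sup>2 + (2 * N - n) * (N - 3 * n) * y + N * (2 * N - n))"
      by (simp add: algebra_simps power2_eq_square)
    finally show ?thesis
      using assms by (simp add: zero_le_mult_iff)
  qed
  also have "\<dots> = 2 * (n\<^sup>2 * y\<^sup>2 + (N\<^sup>2 - 4 * n * N + n\<^sup>2) * y + N\<^sup>2)
      - n * ((y - 1) * (n * y - N))"
    by (simp add: algebra_simps power2_eq_square)
  also have "\<dots> \<le> 2 * (n\<^sup>2 * y\<^sup>2 + (N\<^sup>2 - 4 * n * N + n\<^sup>2) * y + N\<^sup>2)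
      - 1 * ((y - 1) * (n * y - N))"
    using mult_right_mono[OF \<open>1 \<le> n\<close> prod] by simp
  also have "\<dots> = (1 + w) * (N + n * w)
        + 2 * (2 * (N + n * w)\<^sup>2 - (1 + w) * (N * (N + 1) + n * (n + 1) * w))"
    by (simp add: y(3) algebra_simps power2_eq_square)
  finally show "0 \<le> (1 + w) * (N + n * w)
        + 2 * (2 * (N + n * w)\<^sup>2 - (1 + w) * (N * (N + 1) + n * (n + 1) * w))" .
qed fact

text \<open>The lower bound for \<open>w\<close> grows with \<open>e\<close>, so the two are treated
  jointly. The part of the expression divisible by \<open>w\<close> has a cofactor increasing in
  \<open>w\<close>; inserting the full bound in its term \<open>n * w\<close> and only
  \<open>\<rho>\<close> in its term with \<open>e * w\<close> leaves an affine function of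
  \<open>e\<close> with nonnegative coefficients.\<close>

lemma factor_nonneg_large_ratio:
  fixes n N r w e :: real
  assumes "1 \<le> n" "N = 2 * n + r\<^sup>2" "1 \<le> r \<or> r = 0" "0 \<le> e"
    and w: "r ^ 3 / n * (1 + (N - n) * e) \<le> w"
  shows "0 \<le> (1 + e) * ((1 + w) * (N + n * w))
      + 2 * e * (2 * (N + n * w)\<^sup>2 - (1 + w) * (N * (N + 1) + n * (n + 1) * w))"
proof -
  define \<rho> where "\<rho> = r ^ 3 / n"
  have "0 \<le> r" using assms by auto
  then have rho: "\<rho> \<ge> 0" "n * \<rho> = r ^ 3" using assms by (auto simp: \<rho>_def)
  have N: "N \<ge> 2 * n" using assms by simp
  have me: "0 \<le> (N - n) * e" using N assms by simp
  then have w0: "\<rho> \<le> w" "0 \<le> w" and w1: "\<rho> * (1 + (N - n) * e) \<le> w"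
    using w rho mult_nonneg_nonneg[OF rho(1) me] by (auto simp: \<rho>_def[symmetric] algebra_simps)
  \<comment> \<open>This term is negative for \<open>0 < r < 1\<close>, the range excluded by
    hypothesis.\<close>
  have "0 \<le> r\<^sup>2 * ((r - 1) * (r\<^sup>2 - r + 1))"
  proof -
    have "r\<^sup>2 - r + 1 = (r - 1/2)\<^sup>2 + 3/4" by (simp add: algebra_simps power2_eq_square)
    then have "r\<^sup>2 - r + 1 \<ge> 0" by simp
    then show ?thesis using assms by auto
  qed
  moreover have "r ^ 3 * (3 * n - 1) \<ge> r ^ 3 * 2"
    using assms by (intro mult_left_mono) auto
  moreover have "n * n \<ge> 1 * n" using assms by (intro mult_right_mono) auto
  ultimately have "0 \<le> r\<^sup>2 * ((r - 1) * (r\<^sup>2 - r + 1)) + (r ^ 3 * (3 * n - 1) - r ^ 3 * 2)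
      + (6 * (n * n) - 3 * n)"
    using assms(1) by linarith
  also have "\<dots> = r ^ 3 * (3 * n + r\<^sup>2 - 1) + 6 * n * n - 2 * r ^ 4 - 3 * n - r\<^sup>2"
    by (simp add: algebra_simps power_eq_if)
  also have "\<dots> = n * \<rho> * (N + n - 1) + (8 * n * N - 2 * N\<^sup>2 - 2 * n\<^sup>2 - N - n)"
    unfolding rho assms(2) by (simp add: algebra_simps power_eq_if)
  finally have lin: "0 \<le> e * \<dots>" using assms by simp
  have "0 \<le> n * \<rho> + N + n" using rho(1) N assms(1) by simp
  note add_nonneg_nonneg[OF this lin]
  also have "n * \<rho> + N + n + e * (n * \<rho> * (N + n - 1) + (8 * n * N - 2 * N\<^sup>2 - 2 * n\<^sup>2 - N - n))
     = n * (\<rho> * (1 + (N - n) * e)) + (1 + e) * (N + n) + (2 * n - 1) * n * e * \<rho>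
        - 2 * e * (N\<^sup>2 + n\<^sup>2 - 4 * n * N + N + n)"
    by (simp add: algebra_simps power2_eq_square)
  also have "\<dots> \<le> n * w + (1 + e) * (N + n) + (2 * n - 1) * n * e * w
        - 2 * e * (N\<^sup>2 + n\<^sup>2 - 4 * n * N + N + n)"
    using w0 w1 assms(1,4)
    by (intro diff_right_mono add_mono mult_left_mono mult_nonneg_nonneg) auto
  finally have "0 \<le> w * \<dots>" using w0 by simp
  moreover have "0 \<le> (1 + e) * N + 2 * e * (N * (N - 1))"
    using assms(1,4) N by (intro add_nonneg_nonneg mult_nonneg_nonneg) auto
  ultimately show ?thesis by (simp add: algebra_simps power2_eq_square)
qed

section \<open>From admissible parameters to nonnegativity\<close>

text \<open>Both left endpoints are at most \<open>- x\<close>: the square root is at least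
  \<open>2 * x - 3\<close> in the first range and at least \<open>x - 1\<close> in the second, where
  \<open>x - 2 \<le> rho n N\<close>.\<close>

lemma admissible_cases:
  fixes n N :: nat
  assumes "0 < n" "n < N" "admissible n N t"
  obtains "t = 0" | "real n * t \<le> - real N" | "0 \<le> t" "N \<le> 2 * n" | "rho n N \<le> t" "2 * n \<le> N"
proof -
  define x where "x = real N / real n"
  have x: "1 < x" "real N = real n * x" using assms by (auto simp: x_def)
  have neg: "real n * t \<le> - real N" if "t \<le> - x"
    using mult_left_mono[OF that, of "real n"] x by simp
  consider "t = 0"
    | "N \<le> 2 * n" "t \<le> - (1/2) * (3 + sqrt (9 - 4 * x)) \<or> 2 - x \<le> t"
    | "2 * n \<le> N" "t \<le> - (1/2) * (3 + rho n N + sqrt ((3 + rho n N)\<^sup>2 - 4 * x)) \<or> rho n N \<le> t"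
    using assms(3) by (auto simp: admissible_def x_def not_less)
  then show ?thesis
  proof cases
    case 1
    then show ?thesis using that by blast
  next
    case 2
    have "x \<le> 2" using 2 assms by (simp add: x_def divide_simps)
    have "2 * x - 3 \<le> sqrt (9 - 4 * x)"
    proof (rule real_le_rsqrt)
      show "(2 * x - 3)\<^sup>2 \<le> 9 - 4 * x"
        using mult_nonneg_nonneg[of x "2 - x"] x \<open>x \<le> 2\<close>
        by (simp add: power2_eq_square algebra_simps)
    qed
    then have "t \<le> - x \<or> 0 \<le> t" using 2(2) \<open>x \<le> 2\<close> by argo
    then show ?thesis using 2(1) that neg by blast
  next
    case 3
    have "2 \<le> x" using 3 assms by (simp add: x_def divide_simps)
    have "x - 2 \<le> rho n N"
    proof (cases "N = 2 * n")
      case True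
      then show ?thesis using assms by (simp add: rho_def x_def)
    next
      case False
      then have "1 \<le> sqrt (real N - 2 * real n)" using 3 by simp
      then show ?thesis
        using mult_left_mono[of 1 "sqrt (real N - 2 * real n)" "x - 2"] \<open>2 \<le> x\<close>
        by (simp add: rho_def x_def)
    qed
    \<comment> \<open>Used with \<open>(x + 1)\<^sup>2 - 4 * x = (x - 1)\<^sup>2\<close>.\<close>
    then have "(x + 1)\<^sup>2 \<le> (3 + rho n N)\<^sup>2"
      using x by (intro power_mono) auto
    then have "x - 1 \<le> sqrt ((3 + rho n N)\<^sup>2 - 4 * x)"
      by (intro real_le_rsqrt) (simp add: power2_eq_square algebra_simps)
    then have "t \<le> - x \<or> rho n N \<le> t" using 3(2) \<open>x - 2 \<le> rho n N\<close> by argo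
    then show ?thesis using 3(1) that neg by blast
  qed
qed

lemma p_sym_Kt_nonneg:
  fixes n N :: nat
  assumes n: "0 < n" "n < N" and t: "admissible n N t"
  shows "0 \<le> p_sym (Kt n N t) z1 z2 z3"
proof -
  define w where "w = (\<lambda>p::real. t * (1 + p\<^sup>2) ^ (N - n))"
  have pw: "1 + (real N - real n) * p\<^sup>2 \<le> (1 + p\<^sup>2) ^ (N - n)" for p :: real
    using Bernoulli_inequality[of "p\<^sup>2" "N - n"] n
    by (simp add: of_nat_diff) (smt (verit) zero_le_power2)
  have pw1: "1 \<le> (1 + p\<^sup>2) ^ (N - n)" for p :: real
    by (simp add: one_le_power)
  \<comment> \<open>The witness \<open>c\<close> is the sign of \<open>1 + w p\<close>: it is
    \<open>- 1\<close> for \<open>t \<le> - N / n\<close> and \<open>1\<close> in the other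
    cases.\<close>
  have "\<exists>c. c * c = 1 \<and> (\<forall>p. 0 < c * (1 + w p)) \<and>
      (\<forall>p. 0 \<le> (1 + p\<^sup>2) * ((1 + w p) * (real N + real n * w p))
      + 2 * p\<^sup>2 * (2 * (real N + real n * w p)\<^sup>2
          - (1 + w p) * (real N * (real N + 1) + real n * (real n + 1) * w p)))"
    using n t
  proof (cases rule: admissible_cases)
    case 1
    have "real N * real N \<ge> real N * 1" using n by (intro mult_left_mono) auto
    then have "0 \<le> (1 + p\<^sup>2) * real N + 2 * p\<^sup>2 * (2 * (real N)\<^sup>2 - real N * (real N + 1))" for p
      by (intro add_nonneg_nonneg mult_nonneg_nonneg) (auto simp: power2_eq_square algebra_simps)
    then show ?thesis using 1 by (intro exI[of _ 1]) (simp add: w_def)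
  next
    case 2
    have "t \<le> 0" using 2 n by (smt (verit) mult_pos_pos of_nat_0_less_iff of_nat_0_le_iff)
    have w: "w p \<le> t" for p
      using mult_left_mono_neg[OF pw1[of p] \<open>t \<le> 0\<close>] by (simp add: w_def)
    have nw: "real n * w p \<le> - real N" for p
      using mult_left_mono[OF w[of p], of "real n"] 2 by simp
    have "w p < - 1" for p
    proof (rule ccontr)
      assume "\<not> w p < - 1"
      then have "real n * (- 1) \<le> real n * w p" by (intro mult_left_mono) auto
      then show False using nw[of p] n by simp
    qed
    then show ?thesis using n nw
      by (intro exI[of _ "- 1"] conjI allI factor_nonneg_negative) auto
  next
    case 3
    have "0 \<le> w p" for p using 3 by (simp add: w_def)
    then show ?thesis using n 3
      by (intro exI[of _ 1] conjI allI factor_nonneg_small_ratio) (auto simp: add_pos_nonneg)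
  next
    case 4
    define r where "r = sqrt (real N - 2 * real n)"
    have r2: "r\<^sup>2 = real N - 2 * real n" using 4 by (simp add: r_def)
    have rho: "rho n N = r ^ 3 / real n"
    proof -
      have "real N / real n - 2 = r\<^sup>2 / real n"
        using n unfolding r2 by (simp add: field_simps)
      then show ?thesis
        by (simp add: rho_def r_def[symmetric] power3_eq_cube power2_eq_square)
    qed
    have "r \<ge> 0" using 4 by (simp add: r_def)
    \<comment> \<open>The radicand \<open>N - 2 * n\<close> is an integer, so \<open>r\<close> skips
      the interval between 0 and 1.\<close>
    have r1: "1 \<le> r \<or> r = 0"
      using 4 by (cases "N = 2 * n") (auto simp: r_def)
    have "t \<ge> 0" using 4 rho \<open>r \<ge> 0\<close> n by (smt (verit) divide_nonneg_nonneg of_nat_0_le_iff zero_le_power)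
    have wb: "r ^ 3 / real n * (1 + (real N - real n) * p\<^sup>2) \<le> w p" for p
      unfolding w_def using 4 n pw[of p] rho \<open>t \<ge> 0\<close> by (intro mult_mono) auto
    have "0 \<le> w p" for p using \<open>t \<ge> 0\<close> by (simp add: w_def)
    then show ?thesis using n wb r1 r2
      by (intro exI[of _ 1] conjI allI factor_nonneg_large_ratio[of _ _ r]) (auto simp: add_pos_nonneg)
  qed
  then obtain c where c: "c * c = 1" "\<And>p. 0 < c * (1 + w p)"
    and M: "\<And>p. 0 \<le> (1 + p\<^sup>2) * ((1 + w p) * (real N + real n * w p))
      + 2 * p\<^sup>2 * (2 * (real N + real n * w p)\<^sup>2
          - (1 + w p) * (real N * (real N + 1) + real n * (real n + 1) * w p))"
    by blast
  have conv: "convex_on UNIV (\<lambda>p. c * (1 + p\<^sup>2) ^ N / (1 + w p))"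
    using convex_on_quotient[OF n(2), of c t] c(2) M unfolding w_def by blast
  show ?thesis
  proof (rule p_sym_nonneg_if_convex[OF conv])
    fix p
    have "c * (1 + p\<^sup>2) ^ N / (1 + w p) = (c * (1 + w p)) * (1 + p\<^sup>2) ^ N / (1 + w p)\<^sup>2"
      using c(2)[of p] by (auto simp: power2_eq_square)
    also have "\<dots> > 0"
    proof (rule divide_pos_pos[OF mult_pos_pos[OF c(2)]])
      show "0 < (1 + p\<^sup>2) ^ N" by (simp add: add_pos_nonneg)
      show "0 < (1 + w p)\<^sup>2" using c(2)[of p] by auto
    qed
    finally show "0 < c * (1 + p\<^sup>2) ^ N / (1 + w p)" .
  next
    show "Kt n N t z = c / (Re z * (c * (1 + (Im z / Re z)\<^sup>2) ^ N / (1 + w (Im z / Re z))))" for z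
      using Kt_eq[OF n c(1), of t z] by (simp add: w_def)
  qed
qed

section \<open>Sharpness for \<open>N = 2 * n\<close>\<close>

lemma p_sym_Kt_neg:
  fixes n :: nat
  assumes n: "0 < n" and t: "- 2 < t" "t < 0"
  obtains z1 z2 z3 where "z1 \<noteq> z2" "z1 \<noteq> z3" "z2 \<noteq> z3" "p_sym (Kt n (2 * n) t) z1 z2 z3 < 0"
proof -
  \<comment> \<open>The bounds make \<open>v + t\<close> negative and \<open>1 + v + t\<close>
    positive with \<open>0 < v < 1\<close>; such a \<open>v\<close> exists exactly because
    \<open>- 2 < t < 0\<close>.\<close>
  obtain v where v: "max 0 (- 1 - t) < v" "v < min 1 (- t)"
    using dense[of "max 0 (- 1 - t)" "min 1 (- t)"] t by auto
  define u where "u = root n (1 / v)"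
  have u: "u ^ n = 1 / v" "1 < u"
    using v n by (auto simp: u_def)
  define p where "p = sqrt (u - 1)"
  have p: "1 + p\<^sup>2 = u" using u by (simp add: p_def)
  have K: "Kt n (2 * n) t z = (v\<^sup>2 + t * v) / Re z" if "(Im z / Re z)\<^sup>2 = p\<^sup>2" for z
  proof -
    have "Kt n (2 * n) t z = (1 + t * u ^ n) / (Re z * (u ^ n)\<^sup>2)"
      using Kt_eq[of n "2 * n" 1 t z] n unfolding that p
      by (simp add: power_mult mult.commute[of 2 n])
    also have "\<dots> = (v\<^sup>2 + t * v) / Re z"
      using v unfolding u by (cases "Re z = 0") (auto simp: field_simps power2_eq_square)
    finally show ?thesis .
  qed
  \<comment> \<open>The sides \<open>z1 - z2\<close>, \<open>z2 - z3\<close>, \<open>z1 - z3\<close>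
    have slopes \<open>p\<close>, \<open>- p\<close>, 0 and real parts 1, 1, 2.\<close>
  define z1 z2 z3 where "z1 = complex_of_real 2" and "z2 = Complex 1 (- p)" and "z3 = (0::complex)"
  have K2: "Kt n (2 * n) t (z1 - z3) = (1 + t) / 2" "Kt n (2 * n) t (z3 - z1) = - (1 + t) / 2"
    using Kt_eq[of n "2 * n" 1 t] n by (simp_all add: z1_def z3_def field_simps)
  have K1: "Kt n (2 * n) t (z1 - z2) = v\<^sup>2 + t * v" "Kt n (2 * n) t (z2 - z1) = - (v\<^sup>2 + t * v)"
    "Kt n (2 * n) t (z2 - z3) = v\<^sup>2 + t * v" "Kt n (2 * n) t (z3 - z2) = - (v\<^sup>2 + t * v)"
    by (simp_all add: K z1_def z2_def z3_def)
  have "p_sym (Kt n (2 * n) t) z1 z2 z3 = (v * (1 - v)) * ((v + t) * (1 + v + t))"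
    unfolding p_sym_def K1 K2
    by (simp add: field_simps power2_eq_square)
  also have "\<dots> < 0"
    using v by (intro mult_pos_neg mult_neg_pos mult_pos_pos) auto
  finally show ?thesis
    by (rule that[rotated -1]) (auto simp: z1_def z2_def z3_def complex_eq_iff)
qed

theorem theorem1:
  fixes n N :: nat
  assumes "0 < n" and "n < N"
  shows "(\<forall>t::real. admissible n N t \<longrightarrow>
            (\<forall>z1 z2 z3. z1 \<noteq> z2 \<and> z1 \<noteq> z3 \<and> z2 \<noteq> z3 \<longrightarrow>
               0 \<le> p_sym (Kt n N t) z1 z2 z3)) \<and>
         (N = 2 * n \<longrightarrow>
            (\<forall>t::real. admissible n N t \<longleftrightarrow> t \<notin> {-2<..<0}) \<and>
            (\<forall>t\<in>{-2<..<0::real}. \<exists>z1 z2 z3. z1 \<noteq> z2 \<and> z1 \<noteq> z3 \<and> z2 \<noteq> z3 \<and>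
               p_sym (Kt n N t) z1 z2 z3 < 0))"
proof (intro conjI impI allI ballI)
  show "0 \<le> p_sym (Kt n N t) z1 z2 z3" if "admissible n N t" for t z1 z2 z3
    using p_sym_Kt_nonneg[OF assms that] .
next
  fix t assume "N = 2 * n"
  \<comment> \<open>Here \<open>rho n N = 0\<close> and both square roots are 1, so the two excluded
    intervals coincide.\<close>
  then show "admissible n N t \<longleftrightarrow> t \<notin> {-2<..<0}"
    using assms by (auto simp: admissible_def rho_def)
next
  fix t :: real assume "N = 2 * n" "t \<in> {-2<..<0}"
  then show "\<exists>z1 z2 z3. z1 \<noteq> z2 \<and> z1 \<noteq> z3 \<and> z2 \<noteq> z3 \<and> p_sym (Kt n N t) z1 z2 z3 < 0"
    using p_sym_Kt_neg[OF assms(1), of t] by (metis greaterThanLessThan_iff)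
qed

end
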